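(* Let $p$ be a prime number. For any integers $a, m, n \in \{1, 2, \ldots, p-1\}$, we have the following congruence modulo $p$: $$\sum_{k=0}^{p-1} (a+k)^m k^n \equiv \begin{cases} -2, & \text{if } m=n=p-1,\\ -a^{m+n-p+1}\binom{m}{p-1-n}, & \text{otherwise}. \end{cases}$$
   Context: Congruences are in $\mathbb{Z}/p\mathbb{Z}$; negative powers of integers prime to $p$ are powers of the inverse modulo $p$. Binomial coefficients $\binom{u}{v}$ are $0$ unless $0 \le v \le u$. *)

theory Defs
  imports "HOL-Number_Theory.Number_Theory"
begin

text \<open>
  Integer powers modulo \<open>p\<close>: a representative of the power of the residue class of \<open>a\<close>,
  where negative powers are powers of the inverse modulo \<open>p\<close>.  For a negative exponent this is
  only meaningful when \<open>a\<close> is coprime to \<open>p\<close> (otherwise \<open>modular_inverse p a = 0\<close> by convention).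
\<close>

definition mod_powi :: "int \<Rightarrow> int \<Rightarrow> int \<Rightarrow> int" where
  "mod_powi p a e = (if e \<ge> 0 then a ^ nat e else modular_inverse p a ^ nat (- e))"

end

theory Submission
  imports Defs
begin

text \<open>
  Expand \<open>(a + k) ^ m\<close> by the binomial theorem and exchange the two sums.  The inner sums become
  the power sums \<open>\<Sum>k. k ^ (n + j)\<close> over a full set of residues, which for a positive exponent
  are \<open>-1\<close> if \<open>p - 1\<close> divides the exponent and \<open>0\<close> otherwise
  (lemma \<open>power_sum_mod_prime\<close>).  As \<open>1 \<le> n + j \<le> 2 (p - 1)\<close>, only the exponents
  \<open>p - 1\<close> and \<open>2 (p - 1)\<close> can survive.  The first comes from \<open>j = p - 1 - n\<close> and gives the binomial
  coefficient of the statement.  The power of \<open>a\<close> beside it has the exponent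
  \<open>m - j = m + n - p + 1\<close>, which is negative exactly when \<open>j > m\<close>; then the term is absent and
  the binomial coefficient is zero, so that both sides vanish.  The
  exponent \<open>2 (p - 1)\<close> forces \<open>j = m = n = p - 1\<close> and contributes a second \<open>-1\<close>, next to
  \<open>-(a ^ (p - 1))\<close> from \<open>j = 0\<close>, which is \<open>-1\<close> by Fermat's little theorem.
\<close>

lemma sum_mod_prime_eq_sum_totatives:
  fixes f :: "nat \<Rightarrow> 'a :: comm_monoid_add"
  assumes "prime p" and "f 0 = 0"
  shows "(\<Sum>k = 0..p - 1. f k) = (\<Sum>k\<in>totatives p. f k)"
proof -
  have "{0..p - 1} = insert 0 (totatives p)"
    using totatives_prime[OF assms(1)] prime_gt_1_nat[OF assms(1)] by auto
  moreover have "0 \<notin> totatives p"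
    by (simp add: totatives_def)
  ultimately show ?thesis
    using assms(2) by simp
qed

text \<open>
  If \<open>p - 1\<close> divides \<open>t\<close>, this is Fermat's little theorem applied to each nonzero residue.
  Otherwise the nonzero residues are the powers of a primitive root \<open>g\<close>, so that the sum is a
  geometric progression of ratio \<open>g ^ t \<noteq> 1\<close> taken over a full period.
\<close>

lemma power_sum_mod_prime:
  fixes p t :: nat
  assumes p: "prime p" and t: "t > 0"
  shows "[(\<Sum>k = 0..p - 1. int k ^ t) = (if p - 1 dvd t then - 1 else 0)] (mod int p)"
proof -
  have p1: "p > 1" using p by (rule prime_gt_1_nat)
  have tot: "totient p = p - 1" using p by (rule totient_prime)
  have sum_eq: "(\<Sum>k = 0..p - 1. int k ^ t) = (\<Sum>k\<in>totatives p. int k ^ t)"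
    using p t by (intro sum_mod_prime_eq_sum_totatives) auto
  show ?thesis
  proof (cases "p - 1 dvd t")
    case True
    then obtain q where q: "t = (p - 1) * q" by (elim dvdE)
    have "[int k ^ t = 1] (mod int p)" if "k \<in> totatives p" for k
    proof -
      have "[k ^ totient p = 1] (mod p)"
        using that by (intro euler_theorem) (auto simp: totatives_def)
      from cong_pow[OF this, of q] have "[k ^ t = 1] (mod p)"
        by (simp add: q tot power_mult)
      then show ?thesis
        by (metis cong_int_iff of_nat_1 of_nat_power)
    qed
    then have "[(\<Sum>k\<in>totatives p. int k ^ t) = (\<Sum>k\<in>totatives p. 1)] (mod int p)"
      by (rule cong_sum)
    also have "(\<Sum>k\<in>totatives p. 1) = int p - 1"
      using p1 tot by (simp add: totient_def)
    also have "[int p - 1 = - 1] (mod int p)"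
      by (simp add: cong_iff_dvd_diff)
    finally show ?thesis using True sum_eq by simp
  next
    case False
    obtain g where g: "residue_primroot p g"
      using prime_primitive_root_exists[OF p1 p] by blast
    have bij: "bij_betw (\<lambda>i. g ^ i mod p) {..<p - 1} (totatives p)"
      using residue_primroot_is_generator[OF p1 g] tot by simp
    have ord: "ord p g = p - 1"
      using g tot by (simp add: residue_primroot_def)
    define x where "x = int g ^ t"
    have "[(\<Sum>k\<in>totatives p. int k ^ t) = (\<Sum>i<p - 1. x ^ i)] (mod int p)"
    proof -
      have "(\<Sum>k\<in>totatives p. int k ^ t) = (\<Sum>i<p - 1. int (g ^ i mod p) ^ t)"
        by (rule sum.reindex_bij_betw[OF bij, symmetric])
      also have "[\<dots> = (\<Sum>i<p - 1. x ^ i)] (mod int p)"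
      proof (rule cong_sum)
        fix i
        have "[int (g ^ i mod p) = int g ^ i] (mod int p)"
          by (simp add: cong_def zmod_int)
        from cong_pow[OF this, of t] show "[int (g ^ i mod p) ^ t = x ^ i] (mod int p)"
          by (simp add: x_def mult.commute flip: power_mult)
      qed
      finally show ?thesis .
    qed
    moreover have "int p dvd (\<Sum>i<p - 1. x ^ i)"
    proof -
      have "[g ^ t \<noteq> 1] (mod p)"
        using False ord_divides[of g t p] ord by simp
      then have "\<not> int p dvd x - 1"
        by (metis x_def cong_iff_dvd_diff cong_int_iff of_nat_1 of_nat_power)
      moreover have "int p dvd (x - 1) * (\<Sum>i<p - 1. x ^ i)"
      proof -
        have "[g ^ (p - 1) = 1] (mod p)"
          using ord_works[of g p] ord by simp
        from cong_pow[OF this, of t] have "[(g ^ t) ^ (p - 1) = 1] (mod p)"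
          by (simp only: power_one power_mult[symmetric] mult.commute)
        then have "[x ^ (p - 1) = 1] (mod int p)"
          unfolding x_def by (metis cong_int_iff of_nat_1 of_nat_power)
        then show ?thesis
          by (simp add: cong_iff_dvd_diff power_diff_1_eq)
      qed
      ultimately show ?thesis
        using p by (simp add: prime_dvd_mult_iff)
    qed
    ultimately have "int p dvd (\<Sum>k\<in>totatives p. int k ^ t)"
      by (rule cong_dvd_iff[THEN iffD2])
    then show ?thesis
      using False by (simp only: sum_eq cong_0_iff if_False)
  qed
qed

text \<open>
  By the binomial theorem the left-hand side is a combination of power sums, each of which is
  \<open>-1\<close> or \<open>0\<close> modulo \<open>p\<close>.  The hypothesis \<open>n > 0\<close> keeps the exponent \<open>0\<close> out of the expansion: there the
  power sum is \<open>p\<close>, although \<open>p - 1\<close> divides \<open>0\<close>.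
\<close>

lemma shifted_power_sum_mod_prime:
  fixes a :: int
  assumes p: "prime p" and n: "n > 0"
  shows "[(\<Sum>k = 0..p - 1. (a + int k) ^ m * int k ^ n) =
          - (\<Sum>j \<in> {j. j \<le> m \<and> p - 1 dvd n + j}. int (m choose j) * a ^ (m - j))] (mod int p)"
proof -
  define c where "c j = int (m choose j) * a ^ (m - j)" for j
  define e where "e j = (if p - 1 dvd n + j then - 1 else 0 :: int)" for j
  have "(a + int k) ^ m * int k ^ n = (\<Sum>j\<le>m. c j * int k ^ (n + j))" for k
    using binomial_ring[of "int k" a m]
    by (simp add: c_def sum_distrib_left power_add add.commute[of a] mult_ac)
  then have "(\<Sum>k = 0..p - 1. (a + int k) ^ m * int k ^ n) =
        (\<Sum>k = 0..p - 1. \<Sum>j\<le>m. c j * int k ^ (n + j))"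
    by simp
  also have "\<dots> = (\<Sum>j\<le>m. c j * (\<Sum>k = 0..p - 1. int k ^ (n + j)))"
    by (subst sum.swap) (simp add: sum_distrib_left)
  finally have expand: "(\<Sum>k = 0..p - 1. (a + int k) ^ m * int k ^ n) =
    (\<Sum>j\<le>m. c j * (\<Sum>k = 0..p - 1. int k ^ (n + j)))" .
  \<comment> \<open>\<open>e j\<close> is the residue of the power sum of exponent \<open>n + j\<close>.\<close>
  have "(\<Sum>j\<le>m. c j * e j) = (\<Sum>j\<le>m. if p - 1 dvd n + j then - c j else 0)"
    unfolding e_def by (intro sum.cong) auto
  also have "\<dots> = (\<Sum>j \<in> {j \<in> {..m}. p - 1 dvd n + j}. - c j)"
    by (rule sum.inter_filter[symmetric]) (rule finite_atMost)
  also have "\<dots> = - (\<Sum>j \<in> {j. j \<le> m \<and> p - 1 dvd n + j}. c j)"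
    unfolding atMost_iff by (rule sum_negf)
  finally have collect:
    "(\<Sum>j\<le>m. c j * e j) = - (\<Sum>j \<in> {j. j \<le> m \<and> p - 1 dvd n + j}. c j)" .
  have "[(\<Sum>k = 0..p - 1. int k ^ (n + j)) = e j] (mod int p)" for j
    unfolding e_def using n by (intro power_sum_mod_prime p) simp
  then have "[(\<Sum>j\<le>m. c j * (\<Sum>k = 0..p - 1. int k ^ (n + j))) = (\<Sum>j\<le>m. c j * e j)] (mod int p)"
    by (intro cong_sum cong_mult cong_refl)
  then show ?thesis
    unfolding expand collect unfolding c_def .
qed

text \<open>
  The sum \<open>n + j\<close> lies between \<open>1\<close> and \<open>2 d\<close>, where the only multiples of \<open>d\<close> are \<open>d\<close> and \<open>2 d\<close>.
\<close>

lemma dvd_add_iff_of_le: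
  fixes d m n j :: nat
  assumes "n \<in> {1..d}" and "m \<in> {1..d}" and "j \<le> m"
  shows "d dvd n + j \<longleftrightarrow> j = d - n \<or> (n = d \<and> j = d)"
proof
  assume "d dvd n + j"
  then obtain q where q: "n + j = d * q" by (elim dvdE)
  have "n + j \<le> d * 2" using assms by auto
  then have "d * q \<le> d * 2" by (simp only: q)
  moreover have "q \<noteq> 0" using q assms by (intro notI) auto
  ultimately have "q = 1 \<or> q = 2" using assms by auto
  then show "j = d - n \<or> (n = d \<and> j = d)" using q assms by auto
qed (use assms in auto)

theorem theorem2p6:
  fixes p a m n :: nat
  assumes "prime p"
    and "a \<in> {1..p - 1}" and "m \<in> {1..p - 1}" and "n \<in> {1..p - 1}"
  shows "[(\<Sum>k = 0..p - 1. (int a + int k) ^ m * int k ^ n) =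
          (if m = p - 1 \<and> n = p - 1 then - 2
           else - (mod_powi (int p) (int a) (int m + int n - int p + 1)
                   * int (m choose (p - 1 - n))))] (mod int p)"
proof -
  define J where "J = {j. j \<le> m \<and> p - 1 dvd n + j}"
  define S where "S = (\<Sum>j\<in>J. int (m choose j) * int a ^ (m - j))"
  have p1: "p > 1" using assms(1) by (rule prime_gt_1_nat)
  have main: "[(\<Sum>k = 0..p - 1. (int a + int k) ^ m * int k ^ n) = - S] (mod int p)"
    unfolding S_def J_def using assms by (intro shifted_power_sum_mod_prime) auto
  have J: "J = {j. j \<le> m \<and> (j = p - 1 - n \<or> (n = p - 1 \<and> j = p - 1))}"
    using dvd_add_iff_of_le[of n "p - 1" m] assms by (auto simp: J_def)
  show ?thesis
  proof (cases "m = p - 1 \<and> n = p - 1")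
    case True
    then have "J = {0, p - 1}" by (auto simp: J)
    then have S: "S = int a ^ (p - 1) + 1" using p1 True by (simp add: S_def)
    have "\<not> p dvd a" using assms(2) p1 by (auto dest!: dvd_imp_le)
    then have "[a ^ (p - 1) = 1] (mod p)" using assms(1) by (rule fermat_theorem[rotated])
    then have "[int a ^ (p - 1) = 1] (mod int p)"
      by (metis cong_int_iff of_nat_1 of_nat_power)
    then have "[- S = - (1 + 1)] (mod int p)"
      unfolding S by (intro cong_minus_minus_iff[THEN iffD2] cong_add cong_refl)
    with main show ?thesis using True by (auto intro: cong_trans)
  next
    case False
    then have J': "J = {j. j \<le> m \<and> j = p - 1 - n}" using assms by (auto simp: J)
    have "S = mod_powi (int p) (int a) (int m + int n - int p + 1) * int (m choose (p - 1 - n))"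
    proof (cases "p - 1 - n \<le> m")
      case True
      then have "J = {p - 1 - n}" by (auto simp: J')
      moreover have "int m + int n - int p + 1 = int (m - (p - 1 - n))"
        using True assms p1 by auto
      ultimately show ?thesis
        by (simp only: S_def mod_powi_def of_nat_0_le_iff if_True nat_int) simp
    next
      case False
      then have "J = {}" by (auto simp: J')
      with False show ?thesis by (simp add: S_def)
    qed
    with main show ?thesis using False by (simp only: if_False)
  qed
qed

end
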